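(* Let $\vec m$ be an $n\times n$ difference-bound matrix over $\overline{\mathbb I}$ (with $\mathbb I\in\{\mathbb Z,\mathbb Q,\mathbb R\}$), let $v_k$ be a program variable, i.e. $k\in\{2,\dots,n\}$, and let $\vec m_{\backslash v_k}$ be the DBM defined by $$(\vec m_{\backslash v_k})_{ij}=\begin{cases}\min(\vec m_{ij},\ \vec m_{ik}+\vec m_{kj})&\text{if } i\neq k\text{ and }j\neq k,\\ 0&\text{if }i=j=k,\\ +\infty&\text{otherwise.}\end{cases}$$ Then $$\mathcal D^0(\vec m_{\backslash v_k})=\{(x_2,\dots,x_n)\in\mathbb I^{n-1}\;|\;\exists x\in\mathbb I,\ (x_2,\dots,x_{k-1},x,x_{k+1},\dots,x_n)\in\mathcal D^0(\vec m)\}.$$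
   Context: Let $\mathbb I$ be $\mathbb Z$, $\mathbb Q$ or $\mathbb R$, and $\overline{\mathbb I}=\mathbb I\cup\{+\infty\}$ with the usual extended order, minimum and addition. Variables are $v_1,\dots,v_n$, with $v_1$ standing for the constant $0$ and $v_2,\dots,v_n$ the program variables. A difference-bound matrix (DBM) is an $n\times n$ matrix $\vec m$ with entries in $\overline{\mathbb I}$. Define $\mathcal D(\vec m)=\{(x_1,\dots,x_n)\in\mathbb I^n\;|\;\forall i,j,\ x_j-x_i\leq\vec m_{ij}\}$ and the $\mathcal V^0$-domain $\mathcal D^0(\vec m)=\{(x_2,\dots,x_n)\in\mathbb I^{n-1}\;|\;(0,x_2,\dots,x_n)\in\mathcal D(\vec m)\}$.
   Formalization: The formal theorem additionally assumes m_kk ≥ 0; without it the claim fails, e.g. n=k=2, m_11=0, m_12=m_21=+∞, m_22=−1, where D⁰(m) is empty but D⁰(m_{\v_k}) is all of I. *)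

theory Defs
  imports Complex_Main "HOL-Library.FuncSet" "HOL-Library.Extended_Real"
begin

text \<open>
  The scalar set \<open>I\<close> (\<open>\<int>\<close>, \<open>\<rat>\<close> or \<open>\<real>\<close>) is a subset of the reals, so that \<open>I \<union> {+\<infinity>}\<close>, with its
  order, minimum and addition, is a subset of \<^typ>\<open>ereal\<close>. A matrix is a function on pairs of
  indices, of which only the values on \<open>{1..n} \<times> {1..n}\<close> matter; a tuple indexed by a set \<open>A\<close> with
  entries in \<open>I\<close> is an element of \<open>A \<rightarrow>\<^sub>E I\<close>.
\<close>

definition is_DBM :: "real set \<Rightarrow> nat \<Rightarrow> (nat \<Rightarrow> nat \<Rightarrow> ereal) \<Rightarrow> bool" where
  "is_DBM I n m \<longleftrightarrow> (\<forall>i\<in>{1..n}. \<forall>j\<in>{1..n}. m i j \<in> ereal ` I \<union> {\<infinity>})"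

definition V_domain :: "real set \<Rightarrow> nat \<Rightarrow> (nat \<Rightarrow> nat \<Rightarrow> ereal) \<Rightarrow> (nat \<Rightarrow> real) set" where
  "V_domain I n m =
     {x \<in> {1..n} \<rightarrow>\<^sub>E I. \<forall>i\<in>{1..n}. \<forall>j\<in>{1..n}. ereal (x j - x i) \<le> m i j}"

definition V0_domain :: "real set \<Rightarrow> nat \<Rightarrow> (nat \<Rightarrow> nat \<Rightarrow> ereal) \<Rightarrow> (nat \<Rightarrow> real) set" where
  "V0_domain I n m = {x \<in> {2..n} \<rightarrow>\<^sub>E I. x(1 := 0) \<in> V_domain I n m}"

text \<open>
  \<open>forget k m\<close> discards the entry \<open>m k k\<close>. A negative \<open>m k k\<close> makes the domain of \<open>m\<close> empty (it
  requires \<open>x k - x k \<le> m k k\<close>), which \<open>forget k m\<close> need not reflect; the projection property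
  therefore needs \<open>0 \<le> m k k\<close>.
\<close>

definition forget :: "nat \<Rightarrow> (nat \<Rightarrow> nat \<Rightarrow> ereal) \<Rightarrow> nat \<Rightarrow> nat \<Rightarrow> ereal" where
  "forget k m i j =
     (if i \<noteq> k \<and> j \<noteq> k then min (m i j) (m i k + m k j)
      else if i = k \<and> j = k then 0
      else \<infinity>)"

end

theory Submission
  imports Defs
begin

text \<open>
  Fourier-Motzkin elimination of \<open>v\<^sub>k\<close>: the entries \<open>min (m i j) (m i k + m k j)\<close> say that every lower
  bound \<open>x j - m k j\<close> on the value of \<open>v\<^sub>k\<close> is at most every upper bound \<open>x i + m i k\<close>. All finite
  bounds lie in \<open>I\<close>, so the greatest lower bound among them, or the least upper one if there is no
  lower one, is a witness in \<open>I\<close>; density of \<open>I\<close> plays no role.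
\<close>

lemma finite_separation:
  fixes L U I :: "'a :: linorder set"
  assumes "finite L" "finite U" "L \<subseteq> I" "U \<subseteq> I" "I \<noteq> {}"
    and "\<And>l u. l \<in> L \<Longrightarrow> u \<in> U \<Longrightarrow> l \<le> u"
  obtains y where "y \<in> I" "\<And>l. l \<in> L \<Longrightarrow> l \<le> y" "\<And>u. u \<in> U \<Longrightarrow> y \<le> u"
proof (cases "L = {}")
  case False
  then have "Max L \<in> L" using assms(1) by simp
  then show ?thesis using that[of "Max L"] assms by auto
next
  case L: True
  show ?thesis
  proof (cases "U = {}")
    case False
    then have "Min U \<in> U" using assms(2) by simp
    then show ?thesis using that[of "Min U"] assms L by auto
  next
    case True
    then show ?thesis using that L assms(5) by auto
  qed
qed

text \<open>Elimination is carried out on full tuples, where index 1 is an index like any other; the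
  normalisation \<open>x 1 = 0\<close> enters only in the theorem. The closure assumptions are what
  \<int>, \<rat> and \<real> share: they keep every finite bound on the value at \<open>k\<close>
  inside \<open>I\<close>.\<close>

lemma V_domain_forget:
  assumes DBM: "is_DBM I n m" and k: "k \<in> {1..n}" and mkk: "0 \<le> m k k"
    and zero: "0 \<in> I"
    and add: "\<And>a b. a \<in> I \<Longrightarrow> b \<in> I \<Longrightarrow> a + b \<in> I"
    and diff: "\<And>a b. a \<in> I \<Longrightarrow> b \<in> I \<Longrightarrow> a - b \<in> I"
  shows "V_domain I n (forget k m) =
           {x \<in> {1..n} \<rightarrow>\<^sub>E I. \<exists>y\<in>I. x(k := y) \<in> V_domain I n m}"
proof (intro Set.set_eqI iffI)
  fix x assume "x \<in> V_domain I n (forget k m)"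
  then have x: "x \<in> {1..n} \<rightarrow>\<^sub>E I"
    and le: "\<And>i j. i \<in> {1..n} \<Longrightarrow> j \<in> {1..n} \<Longrightarrow> ereal (x j - x i) \<le> forget k m i j"
    by (auto simp: V_domain_def)
  have le_m: "ereal (x j - x i) \<le> m i j" and le_sum: "ereal (x j - x i) \<le> m i k + m k j"
    if "i \<in> {1..n} - {k}" "j \<in> {1..n} - {k}" for i j
    using le[of i j] that by (auto simp: forget_def)
  have entry: "m i j = \<infinity> \<or> (\<exists>c\<in>I. m i j = ereal c)" if "i \<in> {1..n}" "j \<in> {1..n}" for i j
    using DBM that unfolding is_DBM_def by blast
  \<comment> \<open>The constraint \<open>x j - y \<le> m k j\<close> reads
    \<open>x j - m k j \<le> y\<close>. Infinite entries must be filtered out: they constrain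
    nothing, but \<open>real_of_ereal\<close> sends \<infinity> to 0 and would create a false
    bound.\<close>
  define L where "L = (\<lambda>j. x j - real_of_ereal (m k j)) ` {j \<in> {1..n} - {k}. m k j \<noteq> \<infinity>}"
  define U where "U = (\<lambda>i. x i + real_of_ereal (m i k)) ` {i \<in> {1..n} - {k}. m i k \<noteq> \<infinity>}"
  have "L \<subseteq> I"
    unfolding L_def using x entry[OF k] by (fastforce intro!: diff)
  moreover have "U \<subseteq> I"
    unfolding U_def using x entry[OF _ k] by (fastforce intro!: add)
  \<comment> \<open>With \<open>m k j = c\<close> and \<open>m i k = d\<close>, the claim
    \<open>x j - c \<le> x i + d\<close> is \<open>le_sum\<close> rearranged.\<close>
  moreover have "l \<le> u" if l: "l \<in> L" and u: "u \<in> U" for l u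
  proof -
    obtain j where j: "j \<in> {1..n} - {k}" "m k j \<noteq> \<infinity>" "l = x j - real_of_ereal (m k j)"
      using l unfolding L_def by blast
    obtain i where i: "i \<in> {1..n} - {k}" "m i k \<noteq> \<infinity>" "u = x i + real_of_ereal (m i k)"
      using u unfolding U_def by blast
    obtain c d where "m k j = ereal c" "m i k = ereal d"
      using entry[OF k, of j] entry[OF _ k, of i] i j by blast
    then show ?thesis using le_sum[of i j] i j by simp
  qed
  moreover have "finite L" "finite U" "I \<noteq> {}"
    using zero by (auto simp: L_def U_def)
  ultimately obtain y where y: "y \<in> I" "\<And>l. l \<in> L \<Longrightarrow> l \<le> y" "\<And>u. u \<in> U \<Longrightarrow> y \<le> u"
    using finite_separation[of L U I] by metis
  have lower: "ereal (x j - y) \<le> m k j" if "j \<in> {1..n} - {k}" for j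
  proof (cases "m k j = \<infinity>")
    case False
    then have "x j - real_of_ereal (m k j) \<le> y" using that by (intro y) (auto simp: L_def)
    then show ?thesis using entry[OF k, of j] that False by auto
  qed simp
  have upper: "ereal (y - x i) \<le> m i k" if "i \<in> {1..n} - {k}" for i
  proof (cases "m i k = \<infinity>")
    case False
    then have "y \<le> x i + real_of_ereal (m i k)" using that by (intro y) (auto simp: U_def)
    then show ?thesis using entry[OF _ k, of i] that False by auto
  qed simp
  have "x(k := y) \<in> {1..n} \<rightarrow>\<^sub>E I"
    using x y(1) k by (auto simp: PiE_iff extensional_def)
  \<comment> \<open>Off row and column \<open>k\<close> this is \<open>le_m\<close>; row
    \<open>k\<close> is \<open>lower\<close> and column \<open>k\<close> is \<open>upper\<close>. At
    the diagonal entry the difference is 0, which is where \<open>mkk\<close> enters.\<close>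
  moreover have "ereal ((x(k := y)) j - (x(k := y)) i) \<le> m i j"
    if "i \<in> {1..n}" "j \<in> {1..n}" for i j
    using that le_m[of i j] lower[of j] upper[of i] mkk by (auto simp: zero_ereal_def)
  ultimately have "x(k := y) \<in> V_domain I n m"
    unfolding V_domain_def by blast
  then show "x \<in> {x \<in> {1..n} \<rightarrow>\<^sub>E I. \<exists>y\<in>I. x(k := y) \<in> V_domain I n m}"
    using x y(1) by blast
next
  fix x assume "x \<in> {x \<in> {1..n} \<rightarrow>\<^sub>E I. \<exists>y\<in>I. x(k := y) \<in> V_domain I n m}"
  then obtain y where x: "x \<in> {1..n} \<rightarrow>\<^sub>E I"
    and le: "\<And>i j. i \<in> {1..n} \<Longrightarrow> j \<in> {1..n} \<Longrightarrow>
      ereal ((x(k := y)) j - (x(k := y)) i) \<le> m i j"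
    unfolding V_domain_def by blast
  have "ereal (x j - x i) \<le> forget k m i j" if i: "i \<in> {1..n}" and j: "j \<in> {1..n}" for i j
  proof (cases "i \<noteq> k \<and> j \<noteq> k")
    case True
    \<comment> \<open>Inserting the intermediate value \<open>y\<close> turns the constraints at
      \<open>(i, k)\<close> and \<open>(k, j)\<close> into the second argument of the
      minimum.\<close>
    have "ereal (x j - x i) = ereal (y - x i) + ereal (x j - y)" by simp
    also have "\<dots> \<le> m i k + m k j"
      using le[OF i k] le[OF k j] True by (intro add_mono) auto
    finally show ?thesis using le[OF i j] True by (simp add: forget_def)
  qed (auto simp: forget_def)
  then show "x \<in> V_domain I n (forget k m)" using x by (simp add: V_domain_def)
qed

theorem theorem10:
  fixes I :: "real set" and n k :: nat and m :: "nat \<Rightarrow> nat \<Rightarrow> ereal"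
  assumes "I \<in> {\<int>, \<rat>, \<real>}"
    and "is_DBM I n m"
    and "k \<in> {2..n}"
    and "0 \<le> m k k"
  shows "V0_domain I n (forget k m) =
           {x \<in> {2..n} \<rightarrow>\<^sub>E I. \<exists>y\<in>I. x(k := y) \<in> V0_domain I n m}"
proof -
  have I: "0 \<in> I" "\<And>a b. a \<in> I \<Longrightarrow> b \<in> I \<Longrightarrow> a + b \<in> I" "\<And>a b. a \<in> I \<Longrightarrow> b \<in> I \<Longrightarrow> a - b \<in> I"
    using assms(1) by auto
  have k: "k \<in> {1..n}" and k1: "1 \<noteq> k" using assms(3) by auto
  have V: "V_domain I n (forget k m) =
      {x \<in> {1..n} \<rightarrow>\<^sub>E I. \<exists>y\<in>I. x(k := y) \<in> V_domain I n m}"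
    by (rule V_domain_forget[OF assms(2) k assms(4)]) (fact I)+
  \<comment> \<open>Since \<open>k\<close> differs from 1, fixing coordinate 1 at 0 commutes with
    updating coordinate \<open>k\<close>, so the projection of full domains restricts to tuples over
    \<open>{2..n}\<close>.\<close>
  have V0: "x(1 := 0) \<in> V_domain I n (forget k m) \<longleftrightarrow> (\<exists>y\<in>I. x(k := y) \<in> V0_domain I n m)"
    if x: "x \<in> {2..n} \<rightarrow>\<^sub>E I" for x
  proof -
    have "x(1 := 0) \<in> {1..n} \<rightarrow>\<^sub>E I"
      using x I(1) k by (force simp: PiE_iff extensional_def)
    moreover have "x(k := y) \<in> {2..n} \<rightarrow>\<^sub>E I" if "y \<in> I" for y
      using x that assms(3) by (auto simp: PiE_iff extensional_def)
    ultimately show ?thesis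
      unfolding V V0_domain_def mem_Collect_eq fun_upd_twist[OF k1] by blast
  qed
  then show ?thesis unfolding V0_domain_def[of I n "forget k m"] by blast
qed

end
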